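(* Let $p,q,\upsilon,\gamma_1,\dots,\gamma_6,\tau,w\in\mathbb{C}$ with $\operatorname{Re}(p)>0$, $\operatorname{Re}(q)>0$, $\operatorname{Re}(\upsilon)>0$, $\gamma_4,\gamma_5,\gamma_6\notin\{0,-1,-2,\dots\}$ and $\operatorname{Re}(\tau)>0$. Let $b\in\mathbb{R}$ and $t>b$. Then $${}_{t}\mathbb{I}_{b^{+}}^{\tau}\left[(t-b)^{q-1}E_{\gamma_{4},\gamma_{5},\gamma_{6};p;q;\upsilon}^{(\gamma_{1};\gamma_{2};\gamma_{3})}(z,w(t-b))\right]=(t-b)^{q+\tau-1}E_{\gamma_{4},\gamma_{5},\gamma_{6};p;q+\tau;\upsilon}^{(\gamma_{1};\gamma_{2};\gamma_{3})}(z,w(t-b)).$$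
   Context: $(a)_n$ is the Pochhammer symbol. The modified bivariate I-Konhauser Mittag-Leffler function is $$E_{\gamma_{4},\gamma_{5},\gamma_{6};p;q;\upsilon}^{(\gamma_{1};\gamma_{2};\gamma_{3})}(z,t)=\sum_{l=0}^{\infty}\sum_{n=0}^{\infty}\frac{(-1)^{l}(\gamma_{1})_{2l}(\gamma_{2})_{l+n}(\gamma_{3})_{l}\,z^{l}t^{\upsilon n}}{(\gamma_{4})_{l}(\gamma_{5})_{l}(\gamma_{6})_{l}\,\Gamma(p+l)\,\Gamma(q+\upsilon n)\,n!\,l!}.$$ For $s>0$, $(ws)^{\upsilon n}$ means $(w^{\upsilon})^n s^{\upsilon n}$ with a fixed choice of $w^\upsilon$ (and $w^{\upsilon}=0$ if $w=0$). The Riemann-Liouville fractional integral is ${}_{t}\mathbb{I}_{b^{+}}^{\tau}[h](t)=\frac{1}{\Gamma(\tau)}\int_b^t(t-y)^{\tau-1}h(y)\,dy$, $\operatorname{Re}(\tau)>0$, $t>b$. *)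

theory Defs
  imports "HOL-Analysis.Analysis"
begin

text \<open>
  The powers \<open>t\<^sup>\<upsilon>\<^sup>n\<close> of the second variable depend on a choice of \<open>t\<^sup>\<upsilon>\<close>. The function below
  therefore receives the sequence \<open>T n = t\<^sup>\<upsilon>\<^sup>n\<close> itself as its last argument.
\<close>

definition konhauser_ml ::
  "complex \<Rightarrow> complex \<Rightarrow> complex \<Rightarrow> complex \<Rightarrow> complex \<Rightarrow> complex \<Rightarrow>
   complex \<Rightarrow> complex \<Rightarrow> complex \<Rightarrow> complex \<Rightarrow> (nat \<Rightarrow> complex) \<Rightarrow> complex" where
  "konhauser_ml \<gamma>1 \<gamma>2 \<gamma>3 \<gamma>4 \<gamma>5 \<gamma>6 p q \<upsilon> z T =
     (\<Sum>l. \<Sum>n. ((-1) ^ l * pochhammer \<gamma>1 (2 * l) * pochhammer \<gamma>2 (l + n) * pochhammer \<gamma>3 l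
                 * z ^ l * T n)
              / (pochhammer \<gamma>4 l * pochhammer \<gamma>5 l * pochhammer \<gamma>6 l
                 * Gamma (p + of_nat l) * Gamma (q + \<upsilon> * of_nat n) * fact n * fact l))"

text \<open>\<open>W\<close> is one of the (in general many) values of \<open>w\<^sup>\<upsilon>\<close>, for an arbitrary logarithm of \<open>w\<close>.\<close>

definition is_power_value :: "complex \<Rightarrow> complex \<Rightarrow> complex \<Rightarrow> bool" where
  "is_power_value w \<upsilon> W \<longleftrightarrow>
     (if w = 0 then W = 0 else (\<exists>L. exp L = w \<and> W = exp (\<upsilon> * L)))"

text \<open>
  The powers \<open>(w s)\<^sup>\<upsilon>\<^sup>n\<close> for \<open>s > 0\<close>, where \<open>W\<close> is the chosen value of \<open>w\<^sup>\<upsilon>\<close>; the power of the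
  positive real \<open>s\<close> is the principal one.
\<close>

definition scaled_powers :: "complex \<Rightarrow> complex \<Rightarrow> real \<Rightarrow> nat \<Rightarrow> complex" where
  "scaled_powers W \<upsilon> s n = W ^ n * of_real s powr (\<upsilon> * of_nat n)"

lemma is_power_value_powr: "is_power_value w \<upsilon> (w powr \<upsilon>)"
  by (auto simp: is_power_value_def powr_def intro!: exI[of _ "Ln w"])

lemma scaled_powers_principal:
  assumes "s > 0" "w \<noteq> 0"
  shows "scaled_powers (w powr \<upsilon>) \<upsilon> s n = (w * of_real s) powr (\<upsilon> * of_nat n)"
proof -
  have "Ln (w * of_real s) = Ln w + of_real (ln s)"
    using assms Ln_times_of_real[of s w] by (simp add: mult.commute add.commute Ln_of_real)
  then show ?thesis
    using assms
    by (simp add: scaled_powers_def powr_def Ln_of_real exp_of_nat_mult[symmetric]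
        exp_add[symmetric] algebra_simps)
qed

definition RL_integrand :: "complex \<Rightarrow> (real \<Rightarrow> complex) \<Rightarrow> real \<Rightarrow> real \<Rightarrow> complex" where
  "RL_integrand \<tau> h t y = of_real (t - y) powr (\<tau> - 1) * h y"

definition RL_integral :: "complex \<Rightarrow> real \<Rightarrow> (real \<Rightarrow> complex) \<Rightarrow> real \<Rightarrow> complex" where
  "RL_integral \<tau> b h t = 1 / Gamma \<tau> * (LBINT y=b..t. RL_integrand \<tau> h t y)"

text \<open>The library's integral of a non-integrable function is \<open>0\<close>, so existence is a separate predicate.\<close>

definition RL_integrable :: "complex \<Rightarrow> real \<Rightarrow> (real \<Rightarrow> complex) \<Rightarrow> real \<Rightarrow> bool" where
  "RL_integrable \<tau> b h t \<longleftrightarrow> interval_lebesgue_integrable lborel b t (RL_integrand \<tau> h t)"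

end

theory Submission
  imports Defs
begin

text \<open>
  The operator acts on powers of \<open>y - b\<close> through the Beta integral
  \<open>\<integral>\<^sub>b\<^sup>t (t - y)\<^sup>\<tau>\<^sup>-\<^sup>1 (y - b)\<^sup>a\<^sup>-\<^sup>1 dy = (t - b)\<^sup>a\<^sup>+\<^sup>\<tau>\<^sup>-\<^sup>1 Beta a \<tau>\<close>. With \<open>a = q + \<upsilon> n\<close> the factor
  \<open>Gamma a\<close> of \<open>Beta a \<tau>\<close> cancels against the \<open>Gamma (q + \<upsilon> n)\<close> in the denominator of the series,
  \<open>Gamma \<tau>\<close> cancels against the normalisation of the operator, and \<open>Gamma (q + \<tau> + \<upsilon> n)\<close> is left. So the
  identity holds term by term, and the work is to justify the two exchanges of sum and integral.

  The Beta integral for complex parameters (\<open>has_bochner_integral_beta_kernel\<close>) comes from Fubini's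
  theorem: the Gamma densities form a convolution semigroup up to constants, and comparing total
  masses identifies the constant.

  For the exchange, on \<open>b < y < t\<close> the summand with indices \<open>l, n\<close> is at most
  \<open>u l * v n\<close> times the modulus of the kernel \<open>(t - y)\<^sup>\<tau>\<^sup>-\<^sup>1 (y - b)\<^sup>q\<^sup>-\<^sup>1\<close>, which is integrable, where
  \<open>u\<close> and \<open>v\<close> are summable. In \<open>l\<close> there are four factorials' worth of growth in the numerator (two from
  \<open>(\<gamma>1)\<^sub>2\<^sub>l\<close>, one each from \<open>(\<gamma>2)\<^sub>l\<^sub>+\<^sub>n\<close> and \<open>(\<gamma>3)\<^sub>l\<close>) against five in the denominator, so \<open>u\<close> is an
  exponential series (\<open>konhauser_coeff_bound\<close>). In \<open>n\<close> the factorials cancel and the decay comes from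
  \<open>1 / Gamma (q + \<upsilon> n)\<close> alone. Since \<open>\<upsilon>\<close> may be complex, this decay is read off from the ratio of
  consecutive Gamma values, which is \<open>Beta (q + \<upsilon> n) \<upsilon> / Gamma \<upsilon>\<close> and tends to \<open>0\<close> by dominated
  convergence in the Beta integral (\<open>Beta_tendsto_0\<close>, \<open>summable_power_over_Gamma\<close>).
\<close>

section \<open>The Beta integral with complex parameters\<close>

lemma Re_pos_not_nonpos_Int: "Re a > 0 \<Longrightarrow> a \<notin> \<int>\<^sub>\<le>\<^sub>0"
  by (auto elim!: nonpos_Ints_cases)

text \<open>The integrand of Euler's integral, extended by \<open>0\<close> to the whole line so that convolutions make sense.\<close>
definition gamma_kernel :: "complex \<Rightarrow> real \<Rightarrow> complex" where
  "gamma_kernel a x = indicator {0<..} x *\<^sub>R (of_real x powr (a - 1) * of_real (exp (- x)))"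

text \<open>
  The interval is a parameter because two instances are needed: \<open>(0, u)\<close> arises as the convolution
  of two Gamma kernels, and \<open>(b, t)\<close> is the interval of the fractional integral.
\<close>
definition beta_kernel :: "complex \<Rightarrow> complex \<Rightarrow> real \<Rightarrow> real \<Rightarrow> real \<Rightarrow> complex" where
  "beta_kernel a c b t y =
     indicator {b<..<t} y *\<^sub>R (of_real (y - b) powr (a - 1) * of_real (t - y) powr (c - 1))"

lemma has_bochner_integral_gamma_kernel:
  assumes "Re a > 0"
  shows "has_bochner_integral lborel (gamma_kernel a) (Gamma a)"
proof -
  let ?f = "\<lambda>x. complex_of_real x powr (a - 1) / of_real (exp x)"
  have eq: "gamma_kernel a = (\<lambda>x. indicator {0<..} x *\<^sub>R ?f x)"
    by (auto simp: gamma_kernel_def exp_minus field_simps)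
  have meas: "gamma_kernel a \<in> borel_measurable lborel"
    unfolding eq measurable_lborel2
    by (auto intro!: borel_measurable_continuous_on_indicator continuous_intros)
  have abs: "?f absolutely_integrable_on {0<..}"
    by (rule absolutely_integrable_Gamma_integral'[OF assms])
  have "integral\<^sup>L lebesgue (gamma_kernel a) = integral {0<..} ?f"
    using set_lebesgue_integral_eq_integral(2)[OF abs]
    by (simp add: eq set_lebesgue_integral_def)
  also have "\<dots> = Gamma a"
    using Gamma_integral_complex'[OF assms] by (rule integral_unique)
  finally show ?thesis
    using abs meas unfolding has_bochner_integral_iff set_integrable_def eq[symmetric]
    by (simp add: integrable_completion integral_completion)
qed

text \<open>
  Homogeneity: the affine map of \<open>(0, 1)\<close> onto \<open>(b, t)\<close> pulls one power of \<open>t - b\<close> out of each factor.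
  The Jacobian later raises the exponent \<open>a + c - 2\<close> by one.
\<close>
lemma beta_kernel_affine:
  assumes "b < t"
  shows "beta_kernel a c b t (b + (t - b) * x)
           = of_real (t - b) powr (a + c - 2) * beta_kernel a c 0 1 x"
proof (cases "0 < x \<and> x < 1")
  case True
  have "b + (t - b) * x < b + (t - b) * 1"
    using True assms by (intro add_strict_left_mono mult_strict_left_mono) auto
  moreover have "(t - b) * x > 0" using True assms by simp
  ultimately have in': "b + (t - b) * x \<in> {b<..<t}" by simp
  have e1: "(b + (t - b) * x) - b = (t - b) * x" "t - (b + (t - b) * x) = (t - b) * (1 - x)"
    by (simp_all add: algebra_simps)
  have "complex_of_real ((t - b) * x) powr (a - 1) =
          of_real (t - b) powr (a - 1) * of_real x powr (a - 1)"
    unfolding of_real_mult using True assms by (intro powr_times_real) auto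
  moreover have "complex_of_real ((t - b) * (1 - x)) powr (c - 1) =
          of_real (t - b) powr (c - 1) * of_real (1 - x) powr (c - 1)"
    unfolding of_real_mult using True assms by (intro powr_times_real) auto
  moreover have "complex_of_real (t - b) powr (a + c - 2) =
      of_real (t - b) powr (a - 1) * of_real (t - b) powr (c - 1)"
    by (simp add: powr_add[symmetric])
  ultimately show ?thesis
    using True in' unfolding beta_kernel_def e1 by simp
next
  case False
  have "b + (t - b) * x \<notin> {b<..<t}"
  proof
    assume *: "b + (t - b) * x \<in> {b<..<t}"
    hence "0 < (t - b) * x" "(t - b) * x < (t - b) * 1" by (auto simp: algebra_simps)
    with assms have "0 < x" "x < 1" by (simp_all add: zero_less_mult_iff mult_less_cancel_left)
    with False show False by simp
  qed
  with False show ?thesis by (auto simp: beta_kernel_def)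
qed

lemma integral_beta_kernel_scale:
  assumes "b < t"
  shows "integral\<^sup>L lborel (beta_kernel a c b t)
           = of_real (t - b) powr (a + c - 1) * integral\<^sup>L lborel (beta_kernel a c 0 1)"
proof -
  have "integral\<^sup>L lborel (beta_kernel a c b t)
      = \<bar>t - b\<bar> *\<^sub>R (\<integral>x. beta_kernel a c b t (b + (t - b) * x) \<partial>lborel)"
    using assms by (intro lborel_integral_real_affine) auto
  also have "\<dots> = (of_real (t - b) powr 1 * of_real (t - b) powr (a + c - 2)) 
       * integral\<^sup>L lborel (beta_kernel a c 0 1)"
    using assms by (simp add: beta_kernel_affine scaleR_conv_of_real del: of_real_diff)
  also have "complex_of_real (t - b) powr 1 * of_real (t - b) powr (a + c - 2) = of_real (t - b) powr (a + c - 1)"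
    unfolding powr_add[symmetric] by (simp add: algebra_simps)
  finally show ?thesis .
qed

text \<open>The modulus only sees the real parts of the exponents, so this reduces to the real Beta integral.\<close>
lemma integrable_beta_kernel_unit:
  assumes "Re a > 0" "Re c > 0"
  shows "integrable lborel (beta_kernel a c 0 1)"
proof (rule Bochner_Integration.integrable_bound[OF _ _ AE_I2])
  show "integrable lborel (\<lambda>x. indicator {0..1} x *\<^sub>R (x powr (Re a - 1) * (1 - x) powr (Re c - 1)))"
    using integrable_Beta[of "Re a" "Re c"] assms by (simp add: set_integrable_def)
  show "beta_kernel a c 0 1 \<in> borel_measurable lborel"
    unfolding beta_kernel_def measurable_lborel2
    by (rule borel_measurable_continuous_on_indicator) (auto intro!: continuous_intros)
  show "norm (beta_kernel a c 0 1 x)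
     \<le> norm (indicator {0..1} x *\<^sub>R (x powr (Re a - 1) * (1 - x) powr (Re c - 1)))" for x
    by (auto simp: beta_kernel_def indicator_def norm_mult norm_powr_real_powr simp flip: of_real_diff)
qed

lemma integrable_beta_kernel:
  assumes "Re a > 0" "Re c > 0" "b < t"
  shows "integrable lborel (beta_kernel a c b t)"
proof -
  have "integrable lborel (\<lambda>x. beta_kernel a c b t (b + (t - b) * x))"
    using integrable_beta_kernel_unit[OF assms(1,2)] assms(3) by (simp add: beta_kernel_affine)
  thus ?thesis
    using assms(3) by (subst (asm) lborel_integrable_real_affine_iff) auto
qed

text \<open>
  \<open>Gamma a * Gamma c\<close> is the total mass of the convolution of the two Gamma kernels. At \<open>u\<close>
  the exponentials combine to \<open>exp (- u)\<close>, and what remains of the convolution is the Beta kernel on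
  \<open>(0, u)\<close>. By homogeneity the convolution is therefore \<open>I\<close> times the Gamma kernel with parameter
  \<open>a + c\<close>, where \<open>I\<close> is the integral sought, and its total mass is \<open>I * Gamma (a + c)\<close>.
\<close>
lemma integral_beta_kernel_unit:
  assumes a: "Re a > 0" and c: "Re c > 0"
  shows "integral\<^sup>L lborel (beta_kernel a c 0 1) = Beta a c"
proof -
  define I where "I = integral\<^sup>L lborel (beta_kernel a c 0 1)"
  note ga = has_bochner_integral_gamma_kernel[OF a]
  note gc = has_bochner_integral_gamma_kernel[OF c]
  have [measurable]: "gamma_kernel a \<in> borel_measurable borel" "gamma_kernel c \<in> borel_measurable borel"
    using ga gc by (auto simp: has_bochner_integral_iff dest: borel_measurable_integrable)
  have shift: "has_bochner_integral lborel (\<lambda>u. gamma_kernel c (u - x)) (Gamma c)" for x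
    using gc lborel_has_bochner_integral_real_affine_iff[of 1 "gamma_kernel c" "Gamma c" "-x"]
    by simp
  have normshift: "(\<integral>u. norm (gamma_kernel c (u - x)) \<partial>lborel) = (\<integral>u. norm (gamma_kernel c u) \<partial>lborel)" for x
    using lborel_integral_real_affine[of 1 "\<lambda>u. norm (gamma_kernel c u)" "-x"] by simp
  have int2: "integrable (lborel \<Otimes>\<^sub>M lborel) (\<lambda>(x, u). gamma_kernel a x * gamma_kernel c (u - x))"
  proof (rule lborel_pair.Fubini_integrable)
    show "(\<lambda>(x, u). gamma_kernel a x * gamma_kernel c (u - x)) \<in> borel_measurable (lborel \<Otimes>\<^sub>M lborel)"
      by measurable
    have "integrable lborel (\<lambda>x. norm (gamma_kernel a x) * (\<integral>u. norm (gamma_kernel c u) \<partial>lborel))"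
      using ga by (intro integrable_mult_left integrable_norm) (simp add: has_bochner_integral_iff)
    thus "integrable lborel (\<lambda>x. \<integral>u. norm (case (x, u) of (x, u) \<Rightarrow> gamma_kernel a x * gamma_kernel c (u - x)) \<partial>lborel)"
      by (simp add: norm_mult normshift)
    show "AE x in lborel. integrable lborel (\<lambda>u. case (x, u) of (x, u) \<Rightarrow> gamma_kernel a x * gamma_kernel c (u - x))"
      using shift by (auto simp: has_bochner_integral_iff intro!: AE_I2)
  qed
  have conv: "(\<integral>x. gamma_kernel a x * gamma_kernel c (u - x) \<partial>lborel) = gamma_kernel (a + c) u * I" for u
  proof (cases "u > 0")
    case True
    have pt: "gamma_kernel a x * gamma_kernel c (u - x) = of_real (exp (- u)) * beta_kernel a c 0 u x" for x
    proof (cases "0 < x \<and> x < u")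
      case True
      have "complex_of_real (exp (- x)) * of_real (exp (- (u - x))) = of_real (exp (- u))"
        unfolding of_real_mult[symmetric] exp_add[symmetric] by simp
      moreover have "gamma_kernel a x * gamma_kernel c (u - x) = (complex_of_real (exp (- x)) * of_real (exp (- (u - x)))) *
         (of_real x powr (a - 1) * of_real (u - x) powr (c - 1))"
        using True by (simp add: gamma_kernel_def)
      ultimately show ?thesis using True by (simp add: beta_kernel_def)
    qed (auto simp: gamma_kernel_def beta_kernel_def indicator_def)
    show ?thesis unfolding pt using True integral_beta_kernel_scale[of 0 u a c]
      by (simp add: I_def gamma_kernel_def)
  next
    case False
    hence pt: "gamma_kernel a x * gamma_kernel c (u - x) = 0" for x
      by (auto simp: gamma_kernel_def indicator_def)
    show ?thesis unfolding pt using False by (simp add: gamma_kernel_def)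
  qed
  have "Gamma a * Gamma c = (\<integral>x. gamma_kernel a x * Gamma c \<partial>lborel)"
    using ga by (simp add: has_bochner_integral_iff)
  also have "\<dots> = (\<integral>x. (\<integral>u. gamma_kernel a x * gamma_kernel c (u - x) \<partial>lborel) \<partial>lborel)"
    using shift by (simp add: has_bochner_integral_iff)
  also have "\<dots> = (\<integral>u. (\<integral>x. gamma_kernel a x * gamma_kernel c (u - x) \<partial>lborel) \<partial>lborel)"
    using lborel_pair.Fubini_integral[OF int2] by simp
  also have "\<dots> = Gamma (a + c) * I"
    using has_bochner_integral_gamma_kernel[of "a + c"] a c
    by (simp add: conv has_bochner_integral_iff)
  finally have "Gamma a * Gamma c = Gamma (a + c) * I" .
  moreover have "Gamma (a + c) \<noteq> 0"
    using a c Re_pos_not_nonpos_Int[of "a + c"] by (simp add: Gamma_eq_zero_iff)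
  ultimately show ?thesis unfolding I_def Beta_def by (simp add: field_simps)
qed

theorem has_bochner_integral_beta_kernel:
  assumes "Re a > 0" "Re c > 0" "b < t"
  shows "has_bochner_integral lborel (beta_kernel a c b t) (of_real (t - b) powr (a + c - 1) * Beta a c)"
  using integrable_beta_kernel[OF assms] integral_beta_kernel_scale[OF assms(3)]
    integral_beta_kernel_unit[OF assms(1,2)]
  by (simp add: has_bochner_integral_iff)

section \<open>Growth of Pochhammer symbols\<close>

text \<open>Each factor satisfies \<open>\<bar>g + k\<bar> \<le> (1 + \<bar>g\<bar>) (k + 1)\<close>.\<close>
lemma norm_pochhammer_le:
  fixes g :: complex
  shows "norm (pochhammer g n) \<le> (1 + norm g) ^ n * fact n"
proof (induction n)
  case (Suc n)
  have "norm (g + of_nat n) \<le> (1 + norm g) * (real n + 1)"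
  proof -
    have "norm (g + of_nat n) \<le> norm g + real n"
      using norm_triangle_ineq[of g "of_nat n"] by simp
    also have "\<dots> \<le> (1 + norm g) * (real n + 1)" by (simp add: algebra_simps)
    finally show ?thesis .
  qed
  hence "norm (pochhammer g n) * norm (g + of_nat n)
      \<le> ((1 + norm g) ^ n * fact n) * ((1 + norm g) * (real n + 1))"
    by (intro mult_mono Suc.IH) auto
  thus ?case by (simp add: pochhammer_Suc norm_mult mult_ac add_ac)
qed auto

text \<open>
  If no factor \<open>g + k\<close> vanishes, the ratios \<open>(k + 1) / (g + k)\<close> are all defined and tend to \<open>1\<close>, so they are
  bounded by some \<open>B\<close>; multiplying the bounds gives the claim with \<open>c = 1 / B\<close>.
\<close>
lemma norm_pochhammer_ge:
  fixes g :: complex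
  assumes "g \<notin> \<int>\<^sub>\<le>\<^sub>0"
  obtains c where "c > 0" "\<And>n. c ^ n * fact n \<le> norm (pochhammer g n)"
proof -
  have nz: "g + of_nat k \<noteq> 0" for k
    using assms plus_of_nat_eq_0_imp[of g k] by auto
  have "filterlim (\<lambda>k. g + of_nat k) at_infinity sequentially"
    by (rule tendsto_add_filterlim_at_infinity[OF tendsto_const tendsto_of_nat])
  hence "(\<lambda>k. 1 + (1 - g) / (g + of_nat k)) \<longlonglongrightarrow> 1 + 0"
    by (intro tendsto_add tendsto_const tendsto_divide_0[OF tendsto_const])
  hence "Bseq (\<lambda>k. 1 + (1 - g) / (g + of_nat k))"
    by (intro convergent_imp_Bseq convergentI)
  then obtain B where B: "B > 0" "\<And>k. norm (1 + (1 - g) / (g + of_nat k)) \<le> B"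
    by (auto elim!: BseqE)
  have step: "1 / B * (real k + 1) \<le> norm (g + of_nat k)" for k
  proof -
    have "1 + (1 - g) / (g + of_nat k) = of_nat (Suc k) / (g + of_nat k)"
      using nz[of k] by (simp add: field_simps)
    with B(2)[of k] have "norm (of_nat (Suc k) :: complex) / norm (g + of_nat k) \<le> B"
      by (simp only: norm_divide)
    hence "real (Suc k) / norm (g + of_nat k) \<le> B" by (simp only: norm_of_nat)
    thus ?thesis using B(1) nz[of k] by (simp add: field_simps)
  qed
  have "(1 / B) ^ n * fact n \<le> norm (pochhammer g n)" for n
  proof (induction n)
    case (Suc n)
    have "((1 / B) ^ n * fact n) * (1 / B * (real n + 1)) \<le> norm (pochhammer g n) * norm (g + of_nat n)"
      using B(1) by (intro mult_mono Suc.IH step) auto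
    thus ?case by (simp add: pochhammer_Suc norm_mult mult_ac add_ac)
  qed auto
  thus ?thesis using B(1) that[of "1 / B"] by simp
qed

lemma fact_add_le: "(fact (m + n) :: real) \<le> 2 ^ (m + n) * fact m * fact n"
proof -
  have "(fact (m + n) :: real) = real ((m + n) choose m) * (fact m * fact n)"
    by (simp add: binomial_fact)
  also have "\<dots> \<le> real (2 ^ (m + n)) * (fact m * fact n)"
    by (intro mult_right_mono of_nat_mono binomial_le_pow2) auto
  finally show ?thesis by (simp add: mult_ac)
qed

section \<open>Super-exponential growth of the Gamma function along a ray\<close>

text \<open>
  Raising the first parameter by \<open>\<upsilon> n\<close> multiplies the integrand of the Beta integral by
  \<open>x\<^sup>\<upsilon>\<^sup>n\<close>. On \<open>(0, 1)\<close> its modulus is at most \<open>1\<close> and tends to \<open>0\<close>, so dominated convergence applies.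
\<close>
lemma Beta_tendsto_0:
  assumes "Re q > 0" "Re c > 0" "Re \<upsilon> > 0"
  shows "(\<lambda>n. Beta (q + \<upsilon> * of_nat n) c) \<longlonglongrightarrow> 0"
proof -
  have Re: "Re (q + \<upsilon> * of_nat n) > 0" for n
    using assms by (simp add: add_pos_nonneg)
  have nb: "norm (beta_kernel (q + \<upsilon> * of_nat n) c 0 1 x) =
      (if 0 < x \<and> x < 1 then (x powr Re \<upsilon>) ^ n else 0) * norm (beta_kernel q c 0 1 x)" for n x
  proof (cases "0 < x \<and> x < 1")
    case True
    have "norm (complex_of_real x powr (q + \<upsilon> * of_nat n - 1)) = x powr (Re q - 1 + Re \<upsilon> * real n)"
      using True by (simp add: norm_powr_real_powr algebra_simps)
    also have "\<dots> = x powr (Re q - 1) * (x powr Re \<upsilon>) powr real n"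
      by (simp only: powr_add powr_powr)
    also have "\<dots> = norm (complex_of_real x powr (q - 1)) * (x powr Re \<upsilon>) ^ n"
      using True by (simp add: norm_powr_real_powr powr_realpow)
    finally show ?thesis
      using True by (simp add: beta_kernel_def norm_mult)
  qed (auto simp: beta_kernel_def)
  have lt1: "x powr Re \<upsilon> < 1" if "0 < x" "x < 1" for x
    using that assms powr_less_mono2[of "Re \<upsilon>" x 1] by simp
  have "(\<lambda>n. integral\<^sup>L lborel (beta_kernel (q + \<upsilon> * of_nat n) c 0 1)) \<longlonglongrightarrow> integral\<^sup>L lborel (\<lambda>x::real. 0::complex)"
  proof (rule integral_dominated_convergence[where w = "\<lambda>x. norm (beta_kernel q c 0 1 x)"])
    show "beta_kernel (q + \<upsilon> * of_nat n) c 0 1 \<in> borel_measurable lborel" for n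
      using integrable_beta_kernel_unit[OF Re assms(2)] by (rule borel_measurable_integrable)
    show "integrable lborel (\<lambda>x. norm (beta_kernel q c 0 1 x))"
      using integrable_beta_kernel_unit[OF assms(1,2)] by (rule integrable_norm)
    show "AE x in lborel. (\<lambda>n. beta_kernel (q + \<upsilon> * of_nat n) c 0 1 x) \<longlonglongrightarrow> 0"
    proof (rule AE_I2, rule tendsto_norm_zero_cancel)
      fix x :: real
      have "(\<lambda>n. (if 0 < x \<and> x < 1 then (x powr Re \<upsilon>) ^ n else 0)) \<longlonglongrightarrow> 0"
      proof (cases "0 < x \<and> x < 1")
        case True
        hence "(\<lambda>n. (x powr Re \<upsilon>) ^ n) \<longlonglongrightarrow> 0"
          using lt1[of x] by (intro LIMSEQ_power_zero) simp
        with True show ?thesis by simp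
      next
        case False
        hence "(\<lambda>n. (if 0 < x \<and> x < 1 then (x powr Re \<upsilon>) ^ n else 0)) = (\<lambda>n. 0)"
          by (simp only: if_False)
        thus ?thesis by (simp only: tendsto_const)
      qed
      thus "(\<lambda>n. norm (beta_kernel (q + \<upsilon> * of_nat n) c 0 1 x)) \<longlonglongrightarrow> 0"
        unfolding nb by (rule tendsto_mult_left_zero)
    qed
    show "AE x in lborel. norm (beta_kernel (q + \<upsilon> * of_nat n) c 0 1 x) \<le> norm (beta_kernel q c 0 1 x)" for n
      unfolding nb using lt1
      by (intro AE_I2 mult_left_le_one_le) (simp_all add: power_le_one less_imp_le)
  qed auto
  thus ?thesis
    by (simp add: integral_beta_kernel_unit[OF Re assms(2)])
qed

text \<open>
  The ratio test: consecutive terms differ by the factor \<open>X * Beta (q + \<upsilon> n) \<upsilon> / Gamma \<upsilon>\<close> in modulus,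
  which tends to \<open>0\<close>.
\<close>
lemma summable_power_over_Gamma:
  assumes "Re q > 0" "Re \<upsilon> > 0"
  shows "summable (\<lambda>n. X ^ n / norm (Gamma (q + \<upsilon> * of_nat n)))"
proof -
  have nz: "Gamma (q + \<upsilon> * of_nat n) \<noteq> 0" for n
    using assms Re_pos_not_nonpos_Int[of "q + \<upsilon> * of_nat n"]
    by (simp add: add_pos_nonneg Gamma_eq_zero_iff)
  have nz': "Gamma \<upsilon> \<noteq> 0"
    using Re_pos_not_nonpos_Int[of \<upsilon>] assms by (simp add: Gamma_eq_zero_iff)
  have "(\<lambda>n. X * norm (Beta (q + \<upsilon> * of_nat n) \<upsilon> / Gamma \<upsilon>)) \<longlonglongrightarrow> X * norm (0 / Gamma \<upsilon>)"
    using nz' by (intro tendsto_intros Beta_tendsto_0 assms)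
  hence "(\<lambda>n. norm (X * norm (Beta (q + \<upsilon> * of_nat n) \<upsilon> / Gamma \<upsilon>))) \<longlonglongrightarrow> 0"
    by (intro tendsto_norm_zero) simp
  hence "eventually (\<lambda>n. norm (X * norm (Beta (q + \<upsilon> * of_nat n) \<upsilon> / Gamma \<upsilon>)) < 1/2) sequentially"
    by (rule order_tendstoD) auto
  then obtain N where N: "\<And>n. n \<ge> N \<Longrightarrow> norm (X * norm (Beta (q + \<upsilon> * of_nat n) \<upsilon> / Gamma \<upsilon>)) < 1/2"
    by (auto simp: eventually_sequentially)
  show ?thesis
  proof (rule summable_ratio_test)
    fix n assume "n \<ge> N"
    define G where "G = Gamma (q + \<upsilon> * of_nat n)"
    define G' where "G' = Gamma (q + \<upsilon> * of_nat (Suc n))"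
    have nzG: "G \<noteq> 0" "G' \<noteq> 0" unfolding G_def G'_def by (rule nz)+
    have "Gamma (q + \<upsilon> * of_nat n + \<upsilon>) = G'"
      unfolding G'_def by (simp add: algebra_simps)
    hence "Beta (q + \<upsilon> * of_nat n) \<upsilon> / Gamma \<upsilon> = G / G'"
      using nz' by (simp add: Beta_def G_def)
    hence "X ^ Suc n / norm G' = X * norm (Beta (q + \<upsilon> * of_nat n) \<upsilon> / Gamma \<upsilon>) * (X ^ n / norm G)"
      using nzG by (simp add: norm_divide)
    hence "norm (X ^ Suc n / norm G') = norm (X * norm (Beta (q + \<upsilon> * of_nat n) \<upsilon> / Gamma \<upsilon>)) * norm (X ^ n / norm G)"
      by (simp only: norm_mult)
    also have "\<dots> \<le> 1/2 * norm (X ^ n / norm G)"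
      using N[OF \<open>n \<ge> N\<close>] by (intro mult_right_mono) auto
    finally show "norm (X ^ Suc n / norm (Gamma (q + \<upsilon> * of_nat (Suc n)))) \<le> 1/2 * norm (X ^ n / norm (Gamma (q + \<upsilon> * of_nat n)))"
      unfolding G_def G'_def .
  qed auto
qed

section \<open>Bounds for the coefficients of the double series\<close>

text \<open>
  The part of the coefficient that the fractional integral leaves unchanged: the power of the second
  variable and \<open>Gamma (q + \<upsilon> n)\<close> are split off.
\<close>
definition konhauser_coeff ::
  "complex \<Rightarrow> complex \<Rightarrow> complex \<Rightarrow> complex \<Rightarrow> complex \<Rightarrow> complex \<Rightarrow>
   complex \<Rightarrow> complex \<Rightarrow> nat \<Rightarrow> nat \<Rightarrow> complex" where
  "konhauser_coeff \<gamma>1 \<gamma>2 \<gamma>3 \<gamma>4 \<gamma>5 \<gamma>6 p z l n =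
     ((-1) ^ l * pochhammer \<gamma>1 (2 * l) * pochhammer \<gamma>2 (l + n) * pochhammer \<gamma>3 l * z ^ l)
     / (pochhammer \<gamma>4 l * pochhammer \<gamma>5 l * pochhammer \<gamma>6 l * Gamma (p + of_nat l) * fact n * fact l)"

lemma konhauser_ml_eq:
  "konhauser_ml \<gamma>1 \<gamma>2 \<gamma>3 \<gamma>4 \<gamma>5 \<gamma>6 p q \<upsilon> z T =
     (\<Sum>l. \<Sum>n. konhauser_coeff \<gamma>1 \<gamma>2 \<gamma>3 \<gamma>4 \<gamma>5 \<gamma>6 p z l n * (T n / Gamma (q + \<upsilon> * of_nat n)))"
  by (simp add: konhauser_ml_def konhauser_coeff_def mult_ac)

text \<open>
  The two indices are coupled only through \<open>(\<gamma>2)\<^sub>l\<^sub>+\<^sub>n\<close>, and \<open>(l + n)! \<le> 2\<^sup>l\<^sup>+\<^sup>n l! n!\<close> separates them. After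
  that \<open>n!\<close> cancels, and \<open>(l!)\<^sup>4\<close> cancels against the denominator, which leaves \<open>X\<^sup>l / l!\<close>
  in \<open>l\<close> and a geometric factor in \<open>n\<close>.
\<close>
lemma konhauser_coeff_bound:
  assumes p: "Re p > 0" and g: "\<gamma>4 \<notin> \<int>\<^sub>\<le>\<^sub>0" "\<gamma>5 \<notin> \<int>\<^sub>\<le>\<^sub>0" "\<gamma>6 \<notin> \<int>\<^sub>\<le>\<^sub>0"
  obtains u D where "summable u" "\<And>l. u l \<ge> 0" "D \<ge> 0"
    "\<And>l n. norm (konhauser_coeff \<gamma>1 \<gamma>2 \<gamma>3 \<gamma>4 \<gamma>5 \<gamma>6 p z l n) \<le> u l * D ^ n"
proof -
  obtain c4 where c4: "c4 > 0" "\<And>n. c4 ^ n * fact n \<le> norm (pochhammer \<gamma>4 n)"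
    using norm_pochhammer_ge[OF g(1)] by blast
  obtain c5 where c5: "c5 > 0" "\<And>n. c5 ^ n * fact n \<le> norm (pochhammer \<gamma>5 n)"
    using norm_pochhammer_ge[OF g(2)] by blast
  obtain c6 where c6: "c6 > 0" "\<And>n. c6 ^ n * fact n \<le> norm (pochhammer \<gamma>6 n)"
    using norm_pochhammer_ge[OF g(3)] by blast
  obtain cp where cp: "cp > 0" "\<And>n. cp ^ n * fact n \<le> norm (pochhammer p n)"
    using norm_pochhammer_ge[OF Re_pos_not_nonpos_Int[OF p]] by blast
  have Gp: "Gamma p \<noteq> 0" using Re_pos_not_nonpos_Int[OF p] by (simp add: Gamma_eq_zero_iff)
  define E1 E2 E3 where "E1 = 1 + norm \<gamma>1" and "E2 = 1 + norm \<gamma>2" and "E3 = 1 + norm \<gamma>3"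
  have E: "E1 > 0" "E2 > 0" "E3 > 0" by (auto simp: E1_def E2_def E3_def add_pos_nonneg)
  define X where "X = (4 * E1\<^sup>2) * (2 * E2) * E3 * norm z / (c4 * c5 * c6 * cp)"
  define u where "u = (\<lambda>l. (X ^ l / fact l) / norm (Gamma p))"
  have X: "X \<ge> 0" using E c4 c5 c6 cp by (auto simp: X_def)
  have "summable (\<lambda>l. inverse (fact l) * X ^ l)" by (rule summable_exp)
  hence "summable u" unfolding u_def
    by (intro summable_divide) (simp add: field_simps)
  moreover have "u l \<ge> 0" for l using X by (simp add: u_def)
  moreover have "norm (konhauser_coeff \<gamma>1 \<gamma>2 \<gamma>3 \<gamma>4 \<gamma>5 \<gamma>6 p z l n) \<le> u l * (2 * E2) ^ n" for l n
  proof -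
    let ?N = "(E1 ^ (2 * l) * (2 ^ (l + l) * fact l * fact l)) * (E2 ^ (l + n) * (2 ^ (l + n) * fact l * fact n))
       * (E3 ^ l * fact l) * norm z ^ l"
    let ?D = "(c4 ^ l * fact l) * (c5 ^ l * fact l) * (c6 ^ l * fact l) * ((cp ^ l * fact l) * norm (Gamma p))
       * fact n * fact l"
    have Gpl: "Gamma (p + of_nat l) = pochhammer p l * Gamma p"
      using pochhammer_Gamma[OF Re_pos_not_nonpos_Int[OF p], of l] Gp by simp
    have n1: "norm (pochhammer \<gamma>1 (2 * l)) \<le> E1 ^ (2 * l) * (2 ^ (l + l) * fact l * fact l)"
    proof -
      have "norm (pochhammer \<gamma>1 (2 * l)) \<le> E1 ^ (2 * l) * fact (2 * l)"
        unfolding E1_def by (rule norm_pochhammer_le)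
      also have "\<dots> \<le> E1 ^ (2 * l) * (2 ^ (l + l) * fact l * fact l)"
        using fact_add_le[of l l] E by (intro mult_left_mono) (auto simp: mult_2)
      finally show ?thesis .
    qed
    have n2: "norm (pochhammer \<gamma>2 (l + n)) \<le> E2 ^ (l + n) * (2 ^ (l + n) * fact l * fact n)"
    proof -
      have "norm (pochhammer \<gamma>2 (l + n)) \<le> E2 ^ (l + n) * fact (l + n)"
        unfolding E2_def by (rule norm_pochhammer_le)
      also have "\<dots> \<le> E2 ^ (l + n) * (2 ^ (l + n) * fact l * fact n)"
        using fact_add_le[of l n] E by (intro mult_left_mono) auto
      finally show ?thesis .
    qed
    have n3: "norm (pochhammer \<gamma>3 l) \<le> E3 ^ l * fact l"
      unfolding E3_def by (rule norm_pochhammer_le)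
    have "norm (konhauser_coeff \<gamma>1 \<gamma>2 \<gamma>3 \<gamma>4 \<gamma>5 \<gamma>6 p z l n) =
      (norm (pochhammer \<gamma>1 (2 * l)) * norm (pochhammer \<gamma>2 (l + n)) * norm (pochhammer \<gamma>3 l) * norm z ^ l) /
      (norm (pochhammer \<gamma>4 l) * norm (pochhammer \<gamma>5 l) * norm (pochhammer \<gamma>6 l)
         * (norm (pochhammer p l) * norm (Gamma p)) * fact n * fact l)"
      unfolding konhauser_coeff_def Gpl by (simp add: norm_mult norm_divide norm_power)
    also have "\<dots> \<le> ?N / ?D"
      using c4 c5 c6 cp E Gp by (intro frac_le mult_mono n1 n2 n3 mult_nonneg_nonneg mult_pos_pos) auto
    also have "\<dots> = u l * (2 * E2) ^ n"
    proof -
      define F :: real where "F = fact l ^ 4 * fact n"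
      have F: "F \<noteq> 0" by (simp add: F_def)
      have e1: "E1 ^ (2 * l) * 2 ^ (l + l) = (4 * E1\<^sup>2) ^ l"
        by (simp add: power_mult power_add power_mult_distrib flip: power_mult_distrib[of 2 2])
      have e2: "E2 ^ (l + n) * 2 ^ (l + n) = (2 * E2) ^ l * (2 * E2) ^ n"
        by (simp add: power_add power_mult_distrib)
      have "?N = (E1 ^ (2 * l) * 2 ^ (l + l)) * (E2 ^ (l + n) * 2 ^ (l + n)) * E3 ^ l * norm z ^ l * F"
        by (simp add: F_def power4_eq_xxxx mult_ac)
      hence "?N / ?D = ((4 * E1\<^sup>2) ^ l * ((2 * E2) ^ l * (2 * E2) ^ n) * E3 ^ l * norm z ^ l * F) /
          ((c4 ^ l * c5 ^ l * c6 ^ l * cp ^ l) * norm (Gamma p) * fact l * F)"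
        unfolding e1 e2 by (simp add: F_def power4_eq_xxxx mult_ac)
      also have "\<dots> = ((4 * E1\<^sup>2) ^ l * ((2 * E2) ^ l * (2 * E2) ^ n) * E3 ^ l * norm z ^ l) /
          ((c4 ^ l * c5 ^ l * c6 ^ l * cp ^ l) * norm (Gamma p) * fact l)"
        using F by (rule mult_divide_mult_cancel_right)
      also have "\<dots> = u l * (2 * E2) ^ n"
        unfolding u_def X_def power_mult_distrib power_divide by (simp add: mult_ac)
      finally show ?thesis .
    qed
    finally show ?thesis .
  qed
  ultimately show ?thesis using E(2) by (intro that[of u "2 * E2"]) auto
qed

section \<open>Integration of dominated double series\<close>

text \<open>
  A constant moves out of both sums only if both sums converge, which the product bound ensures.
\<close>
lemma double_series_scale:
  fixes f :: "nat \<Rightarrow> nat \<Rightarrow> complex"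
  assumes "summable u" "summable v" "\<And>l n. norm (f l n) \<le> u l * v n"
  shows "(\<Sum>l. \<Sum>n. k * f l n) = k * (\<Sum>l. \<Sum>n. f l n)"
proof -
  have s1: "summable (\<lambda>n. f l n)" for l
    by (rule summable_comparison_test'[OF summable_mult[OF assms(2), of "u l"]]) (rule assms)
  have b: "norm (\<Sum>n. f l n) \<le> u l * suminf v" for l
    unfolding suminf_mult[OF assms(2), symmetric]
    by (intro norm_suminf_le assms summable_mult)
  have s2: "summable (\<lambda>l. \<Sum>n. f l n)"
    by (rule summable_comparison_test'[OF summable_mult2[OF assms(1), of "suminf v"]]) (rule b)
  show "(\<Sum>l. \<Sum>n. k * f l n) = k * (\<Sum>l. \<Sum>n. f l n)"
    by (simp add: suminf_mult s1 s2)
qed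

lemma has_bochner_integral_dominated_series:
  fixes f :: "nat \<Rightarrow> 'a \<Rightarrow> complex"
  assumes f: "\<And>n. has_bochner_integral M (f n) (I n)"
    and b: "\<And>n x. norm (f n x) \<le> v n * G x" and v: "summable v" and G: "integrable M G"
  shows "has_bochner_integral M (\<lambda>x. \<Sum>n. f n x) (\<Sum>n. I n)"
proof -
  have i: "integrable M (f n)" "integral\<^sup>L M (f n) = I n" for n
    using f by (auto simp: has_bochner_integral_iff)
  have 1: "AE x in M. summable (\<lambda>n. norm (f n x))"
  proof (intro AE_I2)
    show "summable (\<lambda>n. norm (f n x))" for x
      by (rule summable_comparison_test'[OF summable_mult2[OF v, of "G x"]]) (simp add: b)
  qed
  have 2: "summable (\<lambda>n. \<integral>x. norm (f n x) \<partial>M)"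
  proof (rule summable_comparison_test'[OF summable_mult2[OF v, of "integral\<^sup>L M G"]])
    fix n
    have "(\<integral>x. norm (f n x) \<partial>M) \<le> (\<integral>x. v n * G x \<partial>M)"
      by (intro integral_mono integrable_norm i b) (use G in auto)
    thus "norm (\<integral>x. norm (f n x) \<partial>M) \<le> v n * integral\<^sup>L M G" by simp
  qed
  show ?thesis
    using integrable_suminf[OF i(1) 1 2] integral_suminf[OF i(1) 1 2]
    by (simp add: has_bochner_integral_iff i(2))
qed

text \<open>
  The product form of the bound lets the single-series lemma be used twice: the inner sums
  are dominated by \<open>u l\<close> times the fixed integrable function \<open>suminf v * G\<close>.
\<close>
lemma has_bochner_integral_dominated_double_series:
  fixes f :: "nat \<Rightarrow> nat \<Rightarrow> 'a \<Rightarrow> complex"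
  assumes f: "\<And>l n. has_bochner_integral M (f l n) (I l n)"
    and b: "\<And>l n x. norm (f l n x) \<le> u l * v n * G x"
    and u: "summable u" and v: "summable v" and G: "integrable M G"
  shows "has_bochner_integral M (\<lambda>x. \<Sum>l. \<Sum>n. f l n x) (\<Sum>l. \<Sum>n. I l n)"
proof (rule has_bochner_integral_dominated_series[OF _ _ u])
  show "has_bochner_integral M (\<lambda>x. \<Sum>n. f l n x) (\<Sum>n. I l n)" for l
  proof (rule has_bochner_integral_dominated_series[OF f _ v])
    show "norm (f l n x) \<le> v n * (u l * G x)" for n x using b[of l n x] by (simp add: mult_ac)
  qed (use G in auto)
  show "integrable M (\<lambda>x. suminf v * G x)" using G by simp
  show "norm (\<Sum>n. f l n x) \<le> u l * (suminf v * G x)" for l x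
  proof -
    have "norm (\<Sum>n. f l n x) \<le> (\<Sum>n. v n * (u l * G x))"
      using b[of l _ x] by (intro norm_suminf_le summable_mult2 v) (simp add: mult_ac)
    also have "\<dots> = suminf v * (u l * G x)" using v by (rule suminf_mult2[symmetric])
    finally show ?thesis by (simp add: mult_ac)
  qed
qed

section \<open>The fractional integral\<close>

theorem theorem46:
  fixes p q \<upsilon> \<gamma>1 \<gamma>2 \<gamma>3 \<gamma>4 \<gamma>5 \<gamma>6 \<tau> w W z :: complex
    and b t :: real
  assumes "Re p > 0" and "Re q > 0" and "Re \<upsilon> > 0"
    and "\<gamma>4 \<notin> \<int>\<^sub>\<le>\<^sub>0" and "\<gamma>5 \<notin> \<int>\<^sub>\<le>\<^sub>0" and "\<gamma>6 \<notin> \<int>\<^sub>\<le>\<^sub>0"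
    and "Re \<tau> > 0"
    and "b < t"
    and "is_power_value w \<upsilon> W"
  shows "let h = (\<lambda>y. of_real (y - b) powr (q - 1) *
      konhauser_ml \<gamma>1 \<gamma>2 \<gamma>3 \<gamma>4 \<gamma>5 \<gamma>6 p q \<upsilon> z (scaled_powers W \<upsilon> (y - b)))
    in RL_integrable \<tau> b h t \<and>
       RL_integral \<tau> b h t = of_real (t - b) powr (q + \<tau> - 1) *
         konhauser_ml \<gamma>1 \<gamma>2 \<gamma>3 \<gamma>4 \<gamma>5 \<gamma>6 p (q + \<tau>) \<upsilon> z (scaled_powers W \<upsilon> (t - b))"
proof -
  define A where "A = konhauser_coeff \<gamma>1 \<gamma>2 \<gamma>3 \<gamma>4 \<gamma>5 \<gamma>6 p z"
  obtain u D where u: "summable u" "\<And>l. u l \<ge> 0" and D: "D \<ge> 0"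
    and uD: "\<And>l n. norm (A l n) \<le> u l * D ^ n"
    unfolding A_def using konhauser_coeff_bound[OF assms(1,4,5,6)] by blast
  \<comment> \<open>\<open>y - b\<close> is at most \<open>t - b\<close> and \<open>Re \<upsilon> > 0\<close>, so \<open>S\<close> bounds the modulus of \<open>(y - b)\<^sup>\<upsilon>\<close> uniformly in \<open>y\<close>.\<close>
  define S where "S = (t - b) powr Re \<upsilon>"
  \<comment> \<open>The parameter \<open>r\<close> takes the value \<open>q\<close> for the given series and \<open>q + \<tau>\<close> for the resulting one.\<close>
  define V where "V = (\<lambda>r n. (D * (norm W * S)) ^ n / norm (Gamma (r + \<upsilon> * of_nat n)))"
  have V: "summable (V r)" if "Re r > 0" for r
    unfolding V_def using that assms(3) by (rule summable_power_over_Gamma)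
  define summand where "summand = (\<lambda>r s l n. A l n * (scaled_powers W \<upsilon> s n / Gamma (r + \<upsilon> * of_nat n)))"
  have ml: "konhauser_ml \<gamma>1 \<gamma>2 \<gamma>3 \<gamma>4 \<gamma>5 \<gamma>6 p r \<upsilon> z (scaled_powers W \<upsilon> s) = (\<Sum>l. \<Sum>n. summand r s l n)" for r s
    by (simp add: konhauser_ml_eq summand_def A_def)
  have bound: "norm (summand r s l n) \<le> u l * V r n" if "0 < s" "s \<le> t - b" for r s l n
  proof -
    have "norm (scaled_powers W \<upsilon> s n) = norm W ^ n * (s powr Re \<upsilon>) ^ n"
      using that by (simp add: scaled_powers_def norm_mult norm_power norm_powr_real_powr
          powr_powr flip: powr_realpow)
    also have "\<dots> \<le> norm W ^ n * S ^ n"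
      unfolding S_def using that assms(3) by (intro mult_left_mono power_mono powr_mono2) auto
    finally have "norm (scaled_powers W \<upsilon> s n) \<le> (norm W * S) ^ n" by (simp add: power_mult_distrib)
    hence "norm (summand r s l n) \<le> (u l * D ^ n) * ((norm W * S) ^ n / norm (Gamma (r + \<upsilon> * of_nat n)))"
      unfolding summand_def norm_mult norm_divide using u D
      by (intro mult_mono uD divide_right_mono) auto
    thus ?thesis by (simp add: V_def power_mult_distrib)
  qed
  define h where "h = (\<lambda>y. of_real (y - b) powr (q - 1) *
      konhauser_ml \<gamma>1 \<gamma>2 \<gamma>3 \<gamma>4 \<gamma>5 \<gamma>6 p q \<upsilon> z (scaled_powers W \<upsilon> (y - b)))"
  \<comment> \<open>For the domination the power \<open>(y - b)\<^sup>\<upsilon>\<^sup>n\<close> stays in the summand; for the evaluation in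
    \<open>f_int\<close> it is absorbed into the Beta kernel.\<close>
  define f where "f = (\<lambda>l n y. beta_kernel q \<tau> b t y * summand q (y - b) l n)"
  have Req: "Re (q + \<upsilon> * of_nat n) > 0" for n
    using assms by (simp add: add_pos_nonneg)
  have Gt: "Gamma \<tau> \<noteq> 0"
    using Re_pos_not_nonpos_Int[OF assms(7)] by (simp add: Gamma_eq_zero_iff)
  define k where "k = Gamma \<tau> * of_real (t - b) powr (q + \<tau> - 1)"
  have f_int: "has_bochner_integral lborel (f l n) (k * summand (q + \<tau>) (t - b) l n)" for l n
  proof -
    let ?a = "q + \<upsilon> * of_nat n"
    have feq: "f l n = (\<lambda>y. (A l n * W ^ n / Gamma ?a) * beta_kernel ?a \<tau> b t y)"
    proof
      fix y
      have "complex_of_real (y - b) powr (?a - 1) = of_real (y - b) powr (q - 1) * of_real (y - b) powr (\<upsilon> * of_nat n)"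
        unfolding powr_add[symmetric] by (simp add: algebra_simps)
      thus "f l n y = (A l n * W ^ n / Gamma ?a) * beta_kernel ?a \<tau> b t y"
        by (cases "y \<in> {b<..<t}")
          (simp_all add: f_def beta_kernel_def summand_def scaled_powers_def mult_ac del: of_real_diff)
    qed
    have "complex_of_real (t - b) powr (?a + \<tau> - 1) = of_real (t - b) powr (q + \<tau> - 1) * of_real (t - b) powr (\<upsilon> * of_nat n)"
      unfolding powr_add[symmetric] by (simp add: algebra_simps)
    moreover have "Gamma ?a \<noteq> 0"
      using Re_pos_not_nonpos_Int[OF Req] by (simp add: Gamma_eq_zero_iff)
    moreover have "Gamma (q + \<tau> + \<upsilon> * of_nat n) = Gamma (?a + \<tau>)" by (simp add: add_ac)
    ultimately have "(A l n * W ^ n / Gamma ?a) * (of_real (t - b) powr (?a + \<tau> - 1) * Beta ?a \<tau>)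
        = k * summand (q + \<tau>) (t - b) l n"
      by (simp add: k_def summand_def Beta_def scaled_powers_def del: of_real_diff)
    thus ?thesis
      using has_bochner_integral_mult_right[OF has_bochner_integral_beta_kernel[OF Req assms(7,8)], of "A l n * W ^ n / Gamma ?a" n]
      unfolding feq by simp
  qed
  have "has_bochner_integral lborel (\<lambda>y. \<Sum>l. \<Sum>n. f l n y) (\<Sum>l. \<Sum>n. k * summand (q + \<tau>) (t - b) l n)"
  proof (rule has_bochner_integral_dominated_double_series[OF f_int _ u(1) V[OF assms(2)]])
    show "integrable lborel (\<lambda>y. norm (beta_kernel q \<tau> b t y))"
      using assms by (intro integrable_norm integrable_beta_kernel)
    show "norm (f l n y) \<le> u l * V q n * norm (beta_kernel q \<tau> b t y)" for l n y
    proof (cases "y \<in> {b<..<t}")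
      case True
      thus ?thesis using bound[of "y - b" q l n] 
        by (simp add: f_def norm_mult mult.commute[of "norm (beta_kernel q \<tau> b t y)"] mult_right_mono)
    qed (simp add: f_def beta_kernel_def)
  qed
  also have "(\<Sum>l. \<Sum>n. k * summand (q + \<tau>) (t - b) l n) = k * (\<Sum>l. \<Sum>n. summand (q + \<tau>) (t - b) l n)"
    by (rule double_series_scale[OF u(1) V bound]) (use assms in auto)
  also have "(\<lambda>y. \<Sum>l. \<Sum>n. f l n y) = (\<lambda>y. indicator {b<..<t} y *\<^sub>R RL_integrand \<tau> h t y)"
  proof
    fix y
    show "(\<Sum>l. \<Sum>n. f l n y) = indicator {b<..<t} y *\<^sub>R RL_integrand \<tau> h t y"
    proof (cases "y \<in> {b<..<t}")
      case True
      hence "(\<Sum>l. \<Sum>n. f l n y) = beta_kernel q \<tau> b t y * (\<Sum>l. \<Sum>n. summand q (y - b) l n)"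
        unfolding f_def by (intro double_series_scale[OF u(1) V[OF assms(2)] bound]) auto
      thus ?thesis using True
        by (simp add: beta_kernel_def RL_integrand_def h_def ml)
    qed (simp add: f_def beta_kernel_def)
  qed
  finally have main: "has_bochner_integral lborel (\<lambda>y. indicator {b<..<t} y *\<^sub>R RL_integrand \<tau> h t y)
      (k * (\<Sum>l. \<Sum>n. summand (q + \<tau>) (t - b) l n))" .
  have "RL_integrable \<tau> b h t"
    using main assms(8)
    by (simp add: RL_integrable_def interval_lebesgue_integrable_def set_integrable_def has_bochner_integral_iff)
  moreover have "RL_integral \<tau> b h t = of_real (t - b) powr (q + \<tau> - 1) *
         konhauser_ml \<gamma>1 \<gamma>2 \<gamma>3 \<gamma>4 \<gamma>5 \<gamma>6 p (q + \<tau>) \<upsilon> z (scaled_powers W \<upsilon> (t - b))"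
    using main assms(8) Gt
    by (simp add: RL_integral_def interval_lebesgue_integral_def set_lebesgue_integral_def has_bochner_integral_iff ml k_def)
  ultimately show ?thesis unfolding h_def Let_def by blast
qed

end
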